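(* Let $G$ be a graph. Then all relations $R\subseteq V_G\times V_G$ satisfying $G\ast R=G$ are automorphisms of $G$ if and only if $G$ has property N.
   Context: Graphs are finite and undirected, with loops allowed: $G=(V_G,E_G)$ with $E_G\subseteq V_G\times V_G$ symmetric. For a graph $G$, a finite set $B$ and a relation $R\subseteq V_G\times B$ with full image (for every $b\in B$ there is $v\in V_G$ with $(v,b)\in R$), $G\ast R$ is the graph with vertex set $B$ and edge set $\{(u,v)\in B\times B : \text{there is } (x,y)\in E_G \text{ with } (x,u),(y,v)\in R\}$. The equation $G\ast R=H$ means that $R\subseteq V_G\times V_H$ has full image and $G\ast R$ equals $H$ as a graph. The relations $R$ here are not required to have full domain. A relation $R$ is called an automorphism of $G$ if $R=\{(x,f(x)):x\in V_G\}$ for some graph automorphism $f:V_G\to V_G$ of $G$. Let $N_G(x)=\{z\in V_G:(x,z)\in E_G\}$. $G$ has property N if, for all $x,y\in V_G$, $N_G(x)\subseteq N_G(y)$ implies $x=y$. *)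

theory Defs
  imports "Graph_Theory.Pair_Digraph"
begin

text \<open>Graphs are the library's \<^locale>\<open>pair_pseudo_graph\<close>: a finite vertex set with a symmetric
  arc set of pairs of vertices; loops are allowed.\<close>

definition full_image :: "'a set \<Rightarrow> ('a \<times> 'b) set \<Rightarrow> 'b set \<Rightarrow> bool" where
  "full_image A R B \<longleftrightarrow> (\<forall>b\<in>B. \<exists>v\<in>A. (v, b) \<in> R)"

text \<open>The graph \<open>G * R\<close>. A relation, as a bare set of pairs, does not determine its codomain, so
  the vertex set \<open>B\<close> of the new graph is passed explicitly.\<close>

definition rel_graph ::
  "'a pair_pre_digraph \<Rightarrow> ('a \<times> 'b) set \<Rightarrow> 'b set \<Rightarrow> 'b pair_pre_digraph" where
  "rel_graph G R B = \<lparr> pverts = B,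
     parcs = {(u, v) \<in> B \<times> B. \<exists>(x, y) \<in> parcs G. (x, u) \<in> R \<and> (y, v) \<in> R} \<rparr>"

text \<open>The equation \<open>G * R = H\<close>, which includes that \<open>R\<close> is a relation between the vertex sets with
  full image. The domain of \<open>R\<close> may be a proper subset of the vertices of \<open>G\<close>.\<close>

definition rel_graph_eq ::
  "'a pair_pre_digraph \<Rightarrow> ('a \<times> 'b) set \<Rightarrow> 'b pair_pre_digraph \<Rightarrow> bool" where
  "rel_graph_eq G R H \<longleftrightarrow>
     R \<subseteq> pverts G \<times> pverts H \<and> full_image (pverts G) R (pverts H) \<and>
     rel_graph G R (pverts H) = H"

definition graph_automorphism :: "'a pair_pre_digraph \<Rightarrow> ('a \<Rightarrow> 'a) \<Rightarrow> bool" where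
  "graph_automorphism G f \<longleftrightarrow> bij_betw f (pverts G) (pverts G) \<and>
     (\<forall>x\<in>pverts G. \<forall>y\<in>pverts G. (x, y) \<in> parcs G \<longleftrightarrow> (f x, f y) \<in> parcs G)"

definition automorphism_rel :: "'a pair_pre_digraph \<Rightarrow> ('a \<times> 'a) set \<Rightarrow> bool" where
  "automorphism_rel G R \<longleftrightarrow>
     (\<exists>f. graph_automorphism G f \<and> R = {(x, f x) | x. x \<in> pverts G})"

definition neighbourhood :: "'a pair_pre_digraph \<Rightarrow> 'a \<Rightarrow> 'a set" where
  "neighbourhood G x = {z \<in> pverts G. (x, z) \<in> parcs G}"

definition property_N :: "'a pair_pre_digraph \<Rightarrow> bool" where
  "property_N G \<longleftrightarrow>
     (\<forall>x\<in>pverts G. \<forall>y\<in>pverts G. neighbourhood G x \<subseteq> neighbourhood G y \<longrightarrow> x = y)"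

end

theory Submission
  imports Defs
begin

text \<open>If \<open>N(x) \<subseteq> N(y)\<close> with \<open>x \<noteq> y\<close>, the identity enlarged by the pair \<open>(x, y)\<close> reproduces \<open>G\<close> but
  is not a function. Conversely, let \<open>L\<close> be the finite set of all unions of neighbourhoods. From
  \<open>N(u) = \<Union> {R[N(a)] | (a, u) \<in> R}\<close> it follows that every member of \<open>L\<close> is the \<open>R\<close>-image of a member,
  so by counting \<open>W \<mapsto> R[W]\<close> is a permutation of \<open>L\<close>. By property N the neighbourhoods are the minimal
  nonempty members of \<open>L\<close>, hence \<open>R[N(a)] \<subseteq> N(u)\<close> is an equality whenever \<open>(a, u) \<in> R\<close>. Thus each of
  \<open>a\<close> and \<open>u\<close> determines the other, and \<open>R\<close> is the graph of a permutation.\<close>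

lemma rel_graph_eq_parcs_iff:
  assumes "rel_graph_eq G R H" and "u \<in> pverts H" and "v \<in> pverts H"
  shows "(u, v) \<in> parcs H \<longleftrightarrow> (\<exists>x y. (x, y) \<in> parcs G \<and> (x, u) \<in> R \<and> (y, v) \<in> R)"
proof -
  have "(u, v) \<in> parcs H \<longleftrightarrow> (u, v) \<in> parcs (rel_graph G R (pverts H))"
    using assms(1) by (simp add: rel_graph_eq_def)
  also have "\<dots> \<longleftrightarrow> (\<exists>x y. (x, y) \<in> parcs G \<and> (x, u) \<in> R \<and> (y, v) \<in> R)"
    using assms(2,3) by (auto simp: rel_graph_def)
  finally show ?thesis .
qed

text \<open>As \<open>f\<close> is injective, the only \<open>R\<close>-preimage of
  \<open>f z\<close> is \<open>z\<close>. The witnesses in the edge condition of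
  \<open>rel_graph\<close> are therefore forced, and it becomes preservation of edges in both
  directions.\<close>

lemma automorphism_relI_bij_betw:
  assumes "rel_graph_eq G R G" and "bij_betw f (pverts G) (pverts G)"
    and R: "R = {(x, f x) | x. x \<in> pverts G}"
  shows "automorphism_rel G R"
proof -
  have "(x, y) \<in> parcs G \<longleftrightarrow> (f x, f y) \<in> parcs G" if "x \<in> pverts G" "y \<in> pverts G" for x y
  proof -
    have inj: "inj_on f (pverts G)" and im: "f x \<in> pverts G" "f y \<in> pverts G"
      using assms(2) that by (auto simp: bij_betw_def)
    have "(a, f z) \<in> R \<longleftrightarrow> a = z" if "z \<in> pverts G" for a z
      using that inj by (auto simp: R inj_on_def)
    then show ?thesis
      using rel_graph_eq_parcs_iff[OF assms(1) im] that by simp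
  qed
  then show ?thesis
    using assms(2) R unfolding automorphism_rel_def graph_automorphism_def by blast
qed

context pair_pseudo_graph
begin

lemma mem_neighbourhood_iff: "z \<in> neighbourhood G x \<longleftrightarrow> (x, z) \<in> parcs G"
  by (auto simp: neighbourhood_def dest: in_arcsD2)

text \<open>The extra pair can only move an end of an edge from \<open>x\<close> to
  \<open>y\<close>, and by the inclusion the moved edge is present already. Symmetry covers the
  other end; a loop at \<open>x\<close> is moved one end at a time.\<close>

lemma rel_graph_eq_insert_Id_on:
  assumes "x \<in> pverts G" "y \<in> pverts G" and sub: "neighbourhood G x \<subseteq> neighbourhood G y"
  shows "rel_graph_eq G (insert (x, y) (Id_on (pverts G))) G"
proof -
  let ?R = "insert (x, y) (Id_on (pverts G))"
  have xy: "(y, z) \<in> parcs G" if "(x, z) \<in> parcs G" for z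
    using that sub mem_neighbourhood_iff by blast
  then have yx: "(z, y) \<in> parcs G" if "(z, x) \<in> parcs G" for z
    using that arcs_symmetric by blast
  have edge: "(u, v) \<in> parcs G" if "(a, b) \<in> parcs G" "(a, u) \<in> ?R" "(b, v) \<in> ?R" for a b u v
    using that(2,3) that(1) xy yx by (elim insertE Id_onE) auto
  have "parcs (rel_graph G ?R (pverts G)) = parcs G"
  proof (intro subset_antisym subrelI)
    fix u v assume "(u, v) \<in> parcs (rel_graph G ?R (pverts G))"
    then show "(u, v) \<in> parcs G"
      by (auto simp: rel_graph_def simp del: insert_iff intro: edge)
  next
    fix u v assume "(u, v) \<in> parcs G"
    then show "(u, v) \<in> parcs (rel_graph G ?R (pverts G))"
      using in_arcsD1 in_arcsD2 unfolding rel_graph_def by force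
  qed
  moreover have "pverts (rel_graph G ?R (pverts G)) = pverts G"
    by (simp add: rel_graph_def)
  ultimately have "rel_graph G ?R (pverts G) = G"
    by (intro pair_pre_digraph.equality) auto
  then show ?thesis
    using assms(1,2) by (auto simp: rel_graph_eq_def full_image_def)
qed

text \<open>Fixing one end in the edge condition turns \<open>G * R = G\<close> into an equation
  between vertex sets, a form that passes to unions.\<close>

lemma rel_graph_eq_neighbourhood:
  assumes "rel_graph_eq G R G" and "u \<in> pverts G"
  shows "neighbourhood G u = R `` \<Union> (neighbourhood G ` (R\<inverse> `` {u}))"
proof -
  have R: "R \<subseteq> pverts G \<times> pverts G"
    using assms(1) by (simp add: rel_graph_eq_def)
  have "v \<in> neighbourhood G u \<longleftrightarrow> (\<exists>x y. y \<in> neighbourhood G x \<and> (x, u) \<in> R \<and> (y, v) \<in> R)" for v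
  proof (cases "v \<in> pverts G")
    case True
    with assms show ?thesis
      by (simp add: mem_neighbourhood_iff rel_graph_eq_parcs_iff)
  next
    case False
    then show ?thesis using R by (auto simp: neighbourhood_def)
  qed
  then show ?thesis by blast
qed

lemma rel_graph_eq_inj_on_Image:
  defines "L \<equiv> (\<lambda>S. \<Union> (neighbourhood G ` S)) ` Pow (pverts G)"
  assumes "rel_graph_eq G R G"
  shows "inj_on ((``) R) L" and "(``) R ` L = L"
proof -
  have fin: "finite L" by (simp add: L_def)
  have R: "R \<subseteq> pverts G \<times> pverts G"
    using assms(2) by (simp add: rel_graph_eq_def)
  \<comment> \<open>This inclusion suffices: the image of the finite set \<open>L\<close> has at
    most \<open>card L\<close> members, so covering \<open>L\<close> forces both injectivity and
    equality.\<close>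
  have sub: "L \<subseteq> (``) R ` L"
  proof
    fix W assume "W \<in> L"
    then obtain S where S: "S \<subseteq> pverts G" "W = \<Union> (neighbourhood G ` S)"
      by (auto simp: L_def)
    have "W = (\<Union>u\<in>S. neighbourhood G u)" by (fact S(2))
    also have "\<dots> = (\<Union>u\<in>S. R `` \<Union> (neighbourhood G ` (R\<inverse> `` {u})))"
      by (rule SUP_cong[OF refl rel_graph_eq_neighbourhood[OF assms(2) subsetD[OF S(1)]]])
    \<comment> \<open>Relational images commute with unions, so the preimages of single vertices
      merge into that of \<open>S\<close>.\<close>
    also have "\<dots> = R `` \<Union> (neighbourhood G ` (R\<inverse> `` S))" by blast
    finally have "W = R `` \<Union> (neighbourhood G ` (R\<inverse> `` S))" .
    moreover have "R\<inverse> `` S \<subseteq> pverts G" using R by blast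
    ultimately show "W \<in> (``) R ` L" unfolding L_def by blast
  qed
  then show "inj_on ((``) R) L"
    by (rule finite_surj_inj[OF fin])
  show "(``) R ` L = L"
    using card_seteq[OF finite_imageI[OF fin] sub card_image_le[OF fin]] by simp
qed

lemma Image_neighbourhood_eq:
  assumes N: "property_N G" and eq: "rel_graph_eq G R G" and au: "(a, u) \<in> R"
  shows "R `` neighbourhood G a = neighbourhood G u"
proof -
  let ?L = "(\<lambda>S. \<Union> (neighbourhood G ` S)) ` Pow (pverts G)"
  note bij = rel_graph_eq_inj_on_Image[OF eq]
  have V: "a \<in> pverts G" "u \<in> pverts G"
    using au eq by (auto simp: rel_graph_eq_def)
  show ?thesis
  proof (cases "neighbourhood G a = {}")
    case True
    \<comment> \<open>An empty neighbourhood lies in every neighbourhood.\<close>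
    then have "a = u" using N V by (simp add: property_N_def)
    with True show ?thesis by simp
  next
    case False
    have inL: "neighbourhood G a \<in> ?L" "{} \<in> ?L"
      using V by (auto intro: image_eqI[of _ _ "{a}"] image_eqI[of _ _ "{}"])
    have "R `` neighbourhood G a \<noteq> {}"
      using inj_onD[OF bij(1) _ inL] False by auto
    moreover have "R `` neighbourhood G a \<in> ?L" using bij(2) inL(1) by blast
    then obtain S where S: "S \<subseteq> pverts G" "R `` neighbourhood G a = \<Union> (neighbourhood G ` S)"
      unfolding image_iff by blast
    ultimately have "S \<noteq> {}" by auto
    with S obtain w where w: "w \<in> pverts G" "neighbourhood G w \<subseteq> R `` neighbourhood G a"
      by blast
    have sub: "R `` neighbourhood G a \<subseteq> neighbourhood G u"
      using rel_graph_eq_neighbourhood[OF eq V(2)] au by blast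
    \<comment> \<open>The chain \<open>N(w) \<subseteq> R[N(a)] \<subseteq> N(u)\<close> meets
      property N, and \<open>w = u\<close> collapses it.\<close>
    have "w = u" using N w V sub unfolding property_N_def by blast
    with w sub show ?thesis by blast
  qed
qed

lemma property_N_imp_automorphism_rel:
  assumes N: "property_N G" and eq: "rel_graph_eq G R G"
  shows "automorphism_rel G R"
proof -
  have R: "R \<subseteq> pverts G \<times> pverts G" and full: "\<And>u. u \<in> pverts G \<Longrightarrow> \<exists>a. (a, u) \<in> R"
    using eq by (auto simp: rel_graph_eq_def full_image_def)
  note img = Image_neighbourhood_eq[OF N eq]
  have functional: "u = v" if "(a, u) \<in> R" "(a, v) \<in> R" for a u v
  proof -
    have "u \<in> pverts G" "v \<in> pverts G" using that R by auto
    with N img[OF that(1)] img[OF that(2)] show ?thesis by (simp add: property_N_def)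
  qed
  have injective: "a = b" if "(a, u) \<in> R" "(b, u) \<in> R" for a b u
  proof -
    have ab: "a \<in> pverts G" "b \<in> pverts G" using that R by auto
    have "neighbourhood G a = neighbourhood G b"
      by (rule inj_onD[OF rel_graph_eq_inj_on_Image(1)[OF eq]])
        (use img[OF that(1)] img[OF that(2)] ab
          in \<open>auto intro: image_eqI[of _ _ "{a}"] image_eqI[of _ _ "{b}"]\<close>)
    with N ab show ?thesis by (simp add: property_N_def)
  qed
  \<comment> \<open>Full image provides preimages, while totality of \<open>R\<close> is not given.
    So \<open>g\<close> picks preimages; it is injective since \<open>R\<close> is single-valued,
    hence a permutation of the finite vertex set, and its inverse \<open>f\<close> is a total
    function inside \<open>R\<close>.\<close>
  obtain g where g: "\<And>u. u \<in> pverts G \<Longrightarrow> (g u, u) \<in> R" using full by metis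
  have "inj_on g (pverts G)" using g functional by (metis inj_onI)
  moreover have "g ` pverts G \<subseteq> pverts G" using g R by blast
  ultimately have g_bij: "bij_betw g (pverts G) (pverts G)"
    by (simp add: bij_betw_def endo_inj_surj)
  define f where "f = inv_into (pverts G) g"
  have f_bij: "bij_betw f (pverts G) (pverts G)"
    using bij_betw_inv_into[OF g_bij] by (simp add: f_def)
  have f: "(a, f a) \<in> R" if "a \<in> pverts G" for a
    using g[of "f a"] that bij_betw_inv_into_right[OF g_bij that] bij_betwE[OF f_bij]
    by (simp add: f_def)
  have "R = {(x, f x) | x. x \<in> pverts G}"
    using f functional R by blast
  with eq f_bij show ?thesis by (rule automorphism_relI_bij_betw)
qed

end

theorem theorem4p7:
  fixes G :: "'a pair_pre_digraph"
  assumes "pair_pseudo_graph G"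
  shows "(\<forall>R \<subseteq> pverts G \<times> pverts G. rel_graph_eq G R G \<longrightarrow> automorphism_rel G R)
    \<longleftrightarrow> property_N G"
proof
  interpret pair_pseudo_graph G by fact
  assume aut: "\<forall>R \<subseteq> pverts G \<times> pverts G. rel_graph_eq G R G \<longrightarrow> automorphism_rel G R"
  show "property_N G"
    unfolding property_N_def
  proof (intro ballI impI)
    fix x y
    assume V: "x \<in> pverts G" "y \<in> pverts G" and sub: "neighbourhood G x \<subseteq> neighbourhood G y"
    let ?R = "insert (x, y) (Id_on (pverts G))"
    have "rel_graph_eq G ?R G" using V sub by (rule rel_graph_eq_insert_Id_on)
    moreover from this have "?R \<subseteq> pverts G \<times> pverts G" by (simp add: rel_graph_eq_def)
    ultimately have "automorphism_rel G ?R" using aut by blast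
    then obtain f where f: "?R = {(x, f x) | x. x \<in> pverts G}"
      by (auto simp: automorphism_rel_def)
    have "(x, x) \<in> ?R" "(x, y) \<in> ?R" using V by auto
    then show "x = y" unfolding f by auto
  qed
next
  interpret pair_pseudo_graph G by fact
  assume "property_N G"
  then show "\<forall>R \<subseteq> pverts G \<times> pverts G. rel_graph_eq G R G \<longrightarrow> automorphism_rel G R"
    using property_N_imp_automorphism_rel by blast
qed

end
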